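(* Let $\lambda\in k$. There is a one-to-one correspondence between strict differential 3-Lie 2-algebras with weight $\lambda$ and crossed modules of differential 3-Lie 2-algebras with weight $\lambda$.
   Context: $k$ is a field of characteristic 0; all vector spaces are over $k$. A 3-Lie algebra is a vector space $\mathfrak g$ with a skew-symmetric trilinear bracket satisfying $[x_1,x_2,[y_1,y_2,y_3]]=[[x_1,x_2,y_1],y_2,y_3]+[y_1,[x_1,x_2,y_2],y_3]+[y_1,y_2,[x_1,x_2,y_3]]$. A differential 3-Lie algebra with weight $\lambda$ is a 3-Lie algebra with a linear map $d=d_{\mathfrak g}:\mathfrak g\to\mathfrak g$ such that $d[x_1,x_2,x_3]=[dx_1,x_2,x_3]+[x_1,dx_2,x_3]+[x_1,x_2,dx_3]+\lambda[dx_1,dx_2,x_3]+\lambda[x_1,dx_2,dx_3]+\lambda[dx_1,x_2,dx_3]+\lambda^2[dx_1,dx_2,dx_3]$. Homomorphisms of differential 3-Lie algebras are linear maps preserving brackets and commuting with the operators $d$. A representation of a 3-Lie algebra $\mathfrak g$ is a vector space $V$ with a skew-symmetric bilinear map $\rho:\mathfrak g\wedge\mathfrak g\to gl(V)$ such that $\rho(x_1,x_2)\rho(x_3,x_4)=\rho([x_1,x_2,x_3],x_4)+\rho(x_3,[x_1,x_2,x_4])+\rho(x_3,x_4)\rho(x_1,x_2)$ and $\rho(x_1,[x_2,x_3,x_4])=\rho(x_3,x_4)\rho(x_1,x_2)-\rho(x_2,x_4)\rho(x_1,x_3)+\rho(x_2,x_3)\rho(x_1,x_4)$. A representation $(V,\rho,d_V)$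 of $(\mathfrak g,d)$ has in addition a linear $d_V:V\to V$ with $d_V\rho(x_1,x_2)=\rho(dx_1,x_2)+\rho(x_1,dx_2)+\lambda\rho(dx_1,dx_2)+\rho(x_1,x_2)d_V+\lambda(\rho(dx_1,x_2)+\rho(x_1,dx_2)+\lambda\rho(dx_1,dx_2))d_V$. A strict differential 3-Lie 2-algebra with weight $\lambda$ (i.e. a differential 3-Lie 2-algebra $(\mathfrak g_0,\mathfrak g_1,h,l_3,l_5,d_0,d_1,d_2)$ with $l_5=0$ and $d_2=0$) consists of vector spaces $\mathfrak g_0,\mathfrak g_1$, linear maps $h:\mathfrak g_1\to\mathfrak g_0$, $d_0:\mathfrak g_0\to\mathfrak g_0$, $d_1:\mathfrak g_1\to\mathfrak g_1$, and completely skew-symmetric trilinear maps $l_3:\mathfrak g_i\wedge\mathfrak g_j\wedge\mathfrak g_k\to\mathfrak g_{i+j+k}$ ($0\le i+j+k\le1$), such that for all $x,y,x_i\in\mathfrak g_0$, $a,b\in\mathfrak g_1$: $hl_3(x,y,a)=l_3(x,y,h(a))$, $l_3(a,h(b),x)=l_3(h(a),b,x)$, $d_0h=hd_1$; $l_3(x_1,x_2,l_3(x_3,x_4,x_5))=l_3(x_3,l_3(x_1,x_2,x_4),x_5)+l_3(l_3(x_1,x_2,x_3),x_4,x_5)+l_3(x_3,x_4,l_3(x_1,x_2,x_5))$, and the same identity with $x_1$ replaced by $a\in\mathfrak g_1$, and the same identity with $x_3$ replaced by $a\in\mathfrak g_1$; $d_0l_3(x_1,x_2,x_3)=l_3(d_0x_1,x_2,x_3)+l_3(x_1,d_0x_2,x_3)+l_3(x_1,x_2,d_0x_3)+\lambda(l_3(d_0x_1,d_0x_2,x_3)+l_3(x_1,d_0x_2,d_0x_3)+l_3(d_0x_1,x_2,d_0x_3))+\lambda^2l_3(d_0x_1,d_0x_2,d_0x_3)$;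 $d_1l_3(x_1,x_2,a)=l_3(d_0x_1,x_2,a)+l_3(x_1,d_0x_2,a)+l_3(x_1,x_2,d_1a)+\lambda(l_3(d_0x_1,d_0x_2,a)+l_3(x_1,d_0x_2,d_1a)+l_3(d_0x_1,x_2,d_1a))+\lambda^2l_3(d_0x_1,d_0x_2,d_1a)$. A crossed module of differential 3-Lie 2-algebras (weight $\lambda$) is a sextuple $((\mathfrak g_0,[\cdot,\cdot,\cdot]_{\mathfrak g_0}),(\mathfrak g_1,[\cdot,\cdot,\cdot]_{\mathfrak g_1}),h,\rho,d_0,d_1)$ where $(\mathfrak g_0,[\cdot,\cdot,\cdot]_{\mathfrak g_0},d_0)$ and $(\mathfrak g_1,[\cdot,\cdot,\cdot]_{\mathfrak g_1},d_1)$ are differential 3-Lie algebras of weight $\lambda$, $h:\mathfrak g_1\to\mathfrak g_0$ is a homomorphism of differential 3-Lie algebras, $(\mathfrak g_1,\rho,d_1)$ is a representation of $(\mathfrak g_0,[\cdot,\cdot,\cdot]_{\mathfrak g_0},d_0)$, and for all $x,y\in\mathfrak g_0$, $a,b,c\in\mathfrak g_1$: $h\rho(x,y)a=[x,y,h(a)]_{\mathfrak g_0}$, $\rho(h(a),h(b))c=[a,b,c]_{\mathfrak g_1}$, $\rho(x,h(a))b=-\rho(x,h(b))a$. *)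

theory Defs
  imports Complex_Main
begin

text \<open>
  The ground field is an arbitrary type of class \<open>field_char_0\<close>. A vector space is given by its
  scalar multiplication on an abelian group type, as in \<^locale>\<open>vector_space\<close>. Since
  \<open>\<lambda>\<close> is reserved syntax, the weight is called \<open>w\<close>.
\<close>

definition trilinear ::
  "('k::field \<Rightarrow> 'a::ab_group_add \<Rightarrow> 'a) \<Rightarrow> ('k \<Rightarrow> 'b::ab_group_add \<Rightarrow> 'b) \<Rightarrow>
   ('k \<Rightarrow> 'c::ab_group_add \<Rightarrow> 'c) \<Rightarrow> ('k \<Rightarrow> 'd::ab_group_add \<Rightarrow> 'd) \<Rightarrow>
   ('a \<Rightarrow> 'b \<Rightarrow> 'c \<Rightarrow> 'd) \<Rightarrow> bool"
  where "trilinear s1 s2 s3 s f \<longleftrightarrow>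
    (\<forall>y z. Vector_Spaces.linear s1 s (\<lambda>x. f x y z)) \<and>
    (\<forall>x z. Vector_Spaces.linear s2 s (\<lambda>y. f x y z)) \<and>
    (\<forall>x y. Vector_Spaces.linear s3 s (\<lambda>z. f x y z))"

locale three_lie_algebra = vector_space scale
  for scale :: "'k::field_char_0 \<Rightarrow> 'g::ab_group_add \<Rightarrow> 'g" +
  fixes br :: "'g \<Rightarrow> 'g \<Rightarrow> 'g \<Rightarrow> 'g"
  assumes br_trilinear: "trilinear scale scale scale scale br"
    and br_skew12: "br x y z = - br y x z"
    and br_skew23: "br x y z = - br x z y"
    and br_fundamental:
      "br x1 x2 (br y1 y2 y3) = br (br x1 x2 y1) y2 y3 + br y1 (br x1 x2 y2) y3 + br y1 y2 (br x1 x2 y3)"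

locale differential_three_lie_algebra = three_lie_algebra scale br
  for w :: "'k::field_char_0"
    and scale :: "'k \<Rightarrow> 'g::ab_group_add \<Rightarrow> 'g"
    and br :: "'g \<Rightarrow> 'g \<Rightarrow> 'g \<Rightarrow> 'g" +
  fixes d :: "'g \<Rightarrow> 'g"
  assumes d_linear: "Vector_Spaces.linear scale scale d"
    and d_br:
      "d (br x1 x2 x3) = br (d x1) x2 x3 + br x1 (d x2) x3 + br x1 x2 (d x3)
        + scale w (br (d x1) (d x2) x3) + scale w (br x1 (d x2) (d x3))
        + scale w (br (d x1) x2 (d x3)) + scale (w\<^sup>2) (br (d x1) (d x2) (d x3))"

locale differential_three_lie_hom =
  source: differential_three_lie_algebra w s br d + target: differential_three_lie_algebra w s' br' d'
  for w :: "'k::field_char_0"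
    and s :: "'k \<Rightarrow> 'g::ab_group_add \<Rightarrow> 'g" and br and d
    and s' :: "'k \<Rightarrow> 'h::ab_group_add \<Rightarrow> 'h" and br' and d' +
  fixes f :: "'g \<Rightarrow> 'h"
  assumes hom_linear: "Vector_Spaces.linear s s' f"
    and hom_br: "f (br x y z) = br' (f x) (f y) (f z)"
    and hom_d: "f (d x) = d' (f x)"

text \<open>
  That \<open>\<rho>\<close> is bilinear with values in the linear endomorphisms of \<open>V\<close> is exactly trilinearity of
  \<open>(x, y, v) \<mapsto> \<rho> x y v\<close>.
\<close>

locale three_lie_representation = three_lie_algebra s br
  for s :: "'k::field_char_0 \<Rightarrow> 'g::ab_group_add \<Rightarrow> 'g" and br +
  fixes sV :: "'k \<Rightarrow> 'v::ab_group_add \<Rightarrow> 'v"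
    and \<rho> :: "'g \<Rightarrow> 'g \<Rightarrow> 'v \<Rightarrow> 'v"
  assumes V_vector_space: "vector_space sV"
    and \<rho>_trilinear: "trilinear s s sV sV \<rho>"
    and \<rho>_skew: "\<rho> x y v = - \<rho> y x v"
    and \<rho>_commutator:
      "\<rho> x1 x2 (\<rho> x3 x4 v) = \<rho> (br x1 x2 x3) x4 v + \<rho> x3 (br x1 x2 x4) v + \<rho> x3 x4 (\<rho> x1 x2 v)"
    and \<rho>_br:
      "\<rho> x1 (br x2 x3 x4) v = \<rho> x3 x4 (\<rho> x1 x2 v) - \<rho> x2 x4 (\<rho> x1 x3 v) + \<rho> x2 x3 (\<rho> x1 x4 v)"

locale differential_three_lie_representation =
  differential_three_lie_algebra w s br d + three_lie_representation s br sV \<rho>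
  for w :: "'k::field_char_0"
    and s :: "'k \<Rightarrow> 'g::ab_group_add \<Rightarrow> 'g" and br and d
    and sV :: "'k \<Rightarrow> 'v::ab_group_add \<Rightarrow> 'v" and \<rho> +
  fixes dV :: "'v \<Rightarrow> 'v"
  assumes dV_linear: "Vector_Spaces.linear sV sV dV"
    and dV_\<rho>:
      "dV (\<rho> x1 x2 v) = \<rho> (d x1) x2 v + \<rho> x1 (d x2) v + sV w (\<rho> (d x1) (d x2) v) + \<rho> x1 x2 (dV v)
        + sV w (\<rho> (d x1) x2 (dV v) + \<rho> x1 (d x2) (dV v) + sV w (\<rho> (d x1) (d x2) (dV v)))"

text \<open>
  The operation \<open>l\<^sub>3 : \<gg>\<^sub>i \<and> \<gg>\<^sub>j \<and> \<gg>\<^sub>k \<rightarrow> \<gg>\<^bsub>i+j+k\<^esub>\<close> with \<open>i + j + k \<le> 1\<close> consists of four maps, one for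
  each placement of the (at most one) argument from \<open>\<gg>\<^sub>1\<close>; the digits in the field names are the
  degrees \<open>i j k\<close>. Complete skew-symmetry relates these four maps to one another. It is imposed for
  the two adjacent transpositions, which generate all permutations of the arguments.
\<close>

record ('a, 'b) two_algebra_data =
  sh :: "'b \<Rightarrow> 'a"
  sl000 :: "'a \<Rightarrow> 'a \<Rightarrow> 'a \<Rightarrow> 'a"
  sl001 :: "'a \<Rightarrow> 'a \<Rightarrow> 'b \<Rightarrow> 'b"
  sl010 :: "'a \<Rightarrow> 'b \<Rightarrow> 'a \<Rightarrow> 'b"
  sl100 :: "'b \<Rightarrow> 'a \<Rightarrow> 'a \<Rightarrow> 'b"
  sd0 :: "'a \<Rightarrow> 'a"
  sd1 :: "'b \<Rightarrow> 'b"

locale strict_differential_three_lie_2algebra =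
  fixes w :: "'k::field_char_0"
    and s0 :: "'k \<Rightarrow> 'a::ab_group_add \<Rightarrow> 'a"
    and s1 :: "'k \<Rightarrow> 'b::ab_group_add \<Rightarrow> 'b"
    and h :: "'b \<Rightarrow> 'a"
    and l000 :: "'a \<Rightarrow> 'a \<Rightarrow> 'a \<Rightarrow> 'a"
    and l001 :: "'a \<Rightarrow> 'a \<Rightarrow> 'b \<Rightarrow> 'b"
    and l010 :: "'a \<Rightarrow> 'b \<Rightarrow> 'a \<Rightarrow> 'b"
    and l100 :: "'b \<Rightarrow> 'a \<Rightarrow> 'a \<Rightarrow> 'b"
    and d0 :: "'a \<Rightarrow> 'a"
    and d1 :: "'b \<Rightarrow> 'b"
  assumes vector_space_0: "vector_space s0"
    and vector_space_1: "vector_space s1"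
    and h_linear: "Vector_Spaces.linear s1 s0 h"
    and d0_linear: "Vector_Spaces.linear s0 s0 d0"
    and d1_linear: "Vector_Spaces.linear s1 s1 d1"
    and l000_trilinear: "trilinear s0 s0 s0 s0 l000"
    and l001_trilinear: "trilinear s0 s0 s1 s1 l001"
    and l010_trilinear: "trilinear s0 s1 s0 s1 l010"
    and l100_trilinear: "trilinear s1 s0 s0 s1 l100"
    and l000_skew12: "l000 x y z = - l000 y x z"
    and l000_skew23: "l000 x y z = - l000 x z y"
    and l001_skew12: "l001 x y a = - l001 y x a"
    and l001_skew23: "l001 x y a = - l010 x a y"
    and l010_skew12: "l010 x a y = - l100 a x y"
    and l100_skew23: "l100 a x y = - l100 a y x"
    and h_l3: "h (l001 x y a) = l000 x y (h a)"
    and l3_h: "l100 a (h b) x = l010 (h a) b x"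
    and d_h: "d0 (h a) = h (d1 a)"
    and fundamental:
      "l000 x1 x2 (l000 x3 x4 x5) =
         l000 x3 (l000 x1 x2 x4) x5 + l000 (l000 x1 x2 x3) x4 x5 + l000 x3 x4 (l000 x1 x2 x5)"
    and fundamental_1:
      "l100 a x2 (l000 x3 x4 x5) =
         l010 x3 (l100 a x2 x4) x5 + l100 (l100 a x2 x3) x4 x5 + l001 x3 x4 (l100 a x2 x5)"
    and fundamental_3:
      "l001 x1 x2 (l100 a x4 x5) =
         l100 a (l000 x1 x2 x4) x5 + l100 (l001 x1 x2 a) x4 x5 + l100 a x4 (l000 x1 x2 x5)"
    and d0_l3:
      "d0 (l000 x1 x2 x3) = l000 (d0 x1) x2 x3 + l000 x1 (d0 x2) x3 + l000 x1 x2 (d0 x3)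
        + s0 w (l000 (d0 x1) (d0 x2) x3 + l000 x1 (d0 x2) (d0 x3) + l000 (d0 x1) x2 (d0 x3))
        + s0 (w\<^sup>2) (l000 (d0 x1) (d0 x2) (d0 x3))"
    and d1_l3:
      "d1 (l001 x1 x2 a) = l001 (d0 x1) x2 a + l001 x1 (d0 x2) a + l001 x1 x2 (d1 a)
        + s1 w (l001 (d0 x1) (d0 x2) a + l001 x1 (d0 x2) (d1 a) + l001 (d0 x1) x2 (d1 a))
        + s1 (w\<^sup>2) (l001 (d0 x1) (d0 x2) (d1 a))"

record ('a, 'b) crossed_module_data =
  cbr0 :: "'a \<Rightarrow> 'a \<Rightarrow> 'a \<Rightarrow> 'a"
  cbr1 :: "'b \<Rightarrow> 'b \<Rightarrow> 'b \<Rightarrow> 'b"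
  ch :: "'b \<Rightarrow> 'a"
  crho :: "'a \<Rightarrow> 'a \<Rightarrow> 'b \<Rightarrow> 'b"
  cd0 :: "'a \<Rightarrow> 'a"
  cd1 :: "'b \<Rightarrow> 'b"

locale differential_three_lie_crossed_module =
  g0: differential_three_lie_algebra w s0 br0 d0 +
  g1: differential_three_lie_algebra w s1 br1 d1 +
  hom: differential_three_lie_hom w s1 br1 d1 s0 br0 d0 h +
  rep: differential_three_lie_representation w s0 br0 d0 s1 \<rho> d1
  for w :: "'k::field_char_0"
    and s0 :: "'k \<Rightarrow> 'a::ab_group_add \<Rightarrow> 'a"
    and s1 :: "'k \<Rightarrow> 'b::ab_group_add \<Rightarrow> 'b"
    and br0 br1 h \<rho> d0 d1 +
  assumes h_\<rho>: "h (\<rho> x y a) = br0 x y (h a)"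
    and \<rho>_h_h: "\<rho> (h a) (h b) c = br1 a b c"
    and \<rho>_h_skew: "\<rho> x (h a) b = - \<rho> x (h b) a"

definition strict_2algebras ::
  "'k::field_char_0 \<Rightarrow> ('k \<Rightarrow> 'a::ab_group_add \<Rightarrow> 'a) \<Rightarrow> ('k \<Rightarrow> 'b::ab_group_add \<Rightarrow> 'b) \<Rightarrow>
   ('a, 'b) two_algebra_data set"
  where "strict_2algebras w s0 s1 =
    {S. strict_differential_three_lie_2algebra w s0 s1
          (sh S) (sl000 S) (sl001 S) (sl010 S) (sl100 S) (sd0 S) (sd1 S)}"

definition crossed_modules ::
  "'k::field_char_0 \<Rightarrow> ('k \<Rightarrow> 'a::ab_group_add \<Rightarrow> 'a) \<Rightarrow> ('k \<Rightarrow> 'b::ab_group_add \<Rightarrow> 'b) \<Rightarrow>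
   ('a, 'b) crossed_module_data set"
  where "crossed_modules w s0 s1 =
    {C. differential_three_lie_crossed_module w s0 s1
          (cbr0 C) (cbr1 C) (ch C) (crho C) (cd0 C) (cd1 C)}"

definition crossed_module_of :: "('a, 'b) two_algebra_data \<Rightarrow> ('a, 'b) crossed_module_data"
  where "crossed_module_of S =
    \<lparr> cbr0 = sl000 S,
      cbr1 = (\<lambda>a b c. sl001 S (sh S a) (sh S b) c),
      ch = sh S,
      crho = sl001 S,
      cd0 = sd0 S,
      cd1 = sd1 S \<rparr>"

definition strict_2algebra_of ::
  "('a, 'b::ab_group_add) crossed_module_data \<Rightarrow> ('a, 'b) two_algebra_data"
  where "strict_2algebra_of C =
    \<lparr> sh = ch C,
      sl000 = cbr0 C,
      sl001 = crho C,
      sl010 = (\<lambda>x a y. - crho C x y a),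
      sl100 = (\<lambda>a x y. crho C x y a),
      sd0 = cd0 C,
      sd1 = cd1 C \<rparr>"

end

theory Submission
  imports Defs
begin

text \<open>
  Skew-symmetry expresses \<open>l010\<close> and \<open>l100\<close> through \<open>\<rho> = l001\<close>, namely \<open>l010 x a y = - \<rho> x y a\<close> and
  \<open>l100 a x y = \<rho> x y a\<close>. Under this substitution the axioms of a strict 2-algebra become, one by one,
  the axioms on \<open>(\<gg>\<^sub>0, h, \<rho>)\<close> of a crossed module: \<open>fundamental_1\<close> is \<open>\<rho>_br\<close>, \<open>fundamental_3\<close> is
  \<open>\<rho>_commutator\<close>, \<open>l3_h\<close> is \<open>\<rho>_h_skew\<close>. The bracket \<open>\<rho> (h a) (h b) c\<close> of \<open>\<gg>\<^sub>1\<close> is then a differential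
  3-Lie bracket because \<open>h\<close> is equivariant and commutes with the operators.
\<close>

text \<open>Needed for the bracket \<open>\<rho> (h a) (h b) c\<close>, in which \<open>h\<close>
  enters only the first two arguments.\<close>

lemma trilinear_compose_left:
  assumes f: "trilinear s s s3 s2 f" and h: "Vector_Spaces.linear s1 s h"
  shows "trilinear s1 s1 s3 s2 (\<lambda>a b c. f (h a) (h b) c)"
  unfolding trilinear_def
proof (intro conjI allI)
  fix b c
  have "Vector_Spaces.linear s s2 (\<lambda>x. f x (h b) c)"
    using f by (auto simp: trilinear_def)
  from Vector_Spaces.linear_compose[OF h this]
  show "Vector_Spaces.linear s1 s2 (\<lambda>a. f (h a) (h b) c)" by (simp add: o_def)
next
  fix a c
  have "Vector_Spaces.linear s s2 (\<lambda>y. f (h a) y c)"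
    using f by (auto simp: trilinear_def)
  from Vector_Spaces.linear_compose[OF h this]
  show "Vector_Spaces.linear s1 s2 (\<lambda>b. f (h a) (h b) c)" by (simp add: o_def)
next
  fix a b
  show "Vector_Spaces.linear s3 s2 (\<lambda>c. f (h a) (h b) c)"
    using f by (auto simp: trilinear_def)
qed

lemma trilinear_swap23:
  "trilinear s1 s2 s3 s f \<Longrightarrow> trilinear s1 s3 s2 s (\<lambda>x z y. f x y z)"
  by (auto simp: trilinear_def)

lemma trilinear_rotate:
  "trilinear s1 s2 s3 s f \<Longrightarrow> trilinear s3 s1 s2 s (\<lambda>z x y. f x y z)"
  by (auto simp: trilinear_def)

lemma linear_minus:
  assumes "Vector_Spaces.linear s1 s f"
  shows "Vector_Spaces.linear s1 s (\<lambda>x. - f x)"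
proof -
  interpret f: Vector_Spaces.linear s1 s f by (rule assms)
  show ?thesis
    by unfold_locales (simp_all add: f.add f.scale)
qed

lemma trilinear_neg: "trilinear s1 s2 s3 s f \<Longrightarrow> trilinear s1 s2 s3 s (\<lambda>x y z. - f x y z)"
  by (auto simp: trilinear_def intro: linear_minus)

context strict_differential_three_lie_2algebra
begin

lemma l010_eq: "l010 x a y = - l001 x y a"
  using l001_skew23[of x y a] by simp

lemma l100_eq: "l100 a x y = l001 x y a"
  using l010_skew12[of x a y] l010_eq[of x a y] by simp

lemma three_lie_algebra_0: "three_lie_algebra s0 l000"
proof -
  interpret vector_space s0 by (rule vector_space_0)
  show ?thesis
  proof unfold_locales
    show "l000 x1 x2 (l000 y1 y2 y3)
        = l000 (l000 x1 x2 y1) y2 y3 + l000 y1 (l000 x1 x2 y2) y3 + l000 y1 y2 (l000 x1 x2 y3)"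
      for x1 x2 y1 y2 y3
      \<comment> \<open>A single rewrite: the last summand on the right again matches the left side,
        so the identity would loop as a simp rule. Only the order of the summands differs.\<close>
      by (subst fundamental) (simp add: add_ac)
  qed (fact l000_trilinear l000_skew12 l000_skew23)+
qed

lemma differential_three_lie_algebra_0: "differential_three_lie_algebra w s0 l000 d0"
proof -
  interpret three_lie_algebra s0 l000 by (rule three_lie_algebra_0)
  interpret d0: Vector_Spaces.linear s0 s0 d0 by (rule d0_linear)
  show ?thesis
    by unfold_locales (simp add: d0_l3 scale_right_distrib add_ac)
qed

lemma representation: "differential_three_lie_representation w s0 l000 d0 s1 l001 d1"
proof -
  interpret differential_three_lie_algebra w s0 l000 d0
    by (rule differential_three_lie_algebra_0)
  interpret V: vector_space s1 by (rule vector_space_1)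
  interpret d1: Vector_Spaces.linear s1 s1 d1 by (rule d1_linear)
  show ?thesis
  proof unfold_locales
    show "l001 x1 x2 (l001 x3 x4 v)
        = l001 (l000 x1 x2 x3) x4 v + l001 x3 (l000 x1 x2 x4) v + l001 x3 x4 (l001 x1 x2 v)"
      for x1 x2 x3 x4 v
      using fundamental_3[of x1 x2 v x3 x4] by (simp add: l100_eq add_ac)
    show "l001 x1 (l000 x2 x3 x4) v
        = l001 x3 x4 (l001 x1 x2 v) - l001 x2 x4 (l001 x1 x3 v) + l001 x2 x3 (l001 x1 x4 v)"
      for x1 x2 x3 x4 v
      \<comment> \<open>The minus sign of the middle term comes from the one \<open>l010\<close> in
        \<open>fundamental_1\<close>.\<close>
      using fundamental_1[of v x1 x2 x3 x4] by (simp add: l100_eq l010_eq)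
    show "d1 (l001 x1 x2 v) = l001 (d0 x1) x2 v + l001 x1 (d0 x2) v + s1 w (l001 (d0 x1) (d0 x2) v)
        + l001 x1 x2 (d1 v)
        + s1 w (l001 (d0 x1) x2 (d1 v) + l001 x1 (d0 x2) (d1 v) + s1 w (l001 (d0 x1) (d0 x2) (d1 v)))"
      for x1 x2 v
      \<comment> \<open>The two laws differ only in grouping: the nested factors \<open>w\<close>
        multiply to \<open>w\<^sup>2\<close>.\<close>
      by (simp add: d1_l3 V.scale_right_distrib power2_eq_square add_ac)
  qed (fact l001_trilinear l001_skew12)+
qed

text \<open>In terms of \<open>l001\<close>, the axiom \<open>l3_h\<close> reads
  \<open>l001 (h a) x b = - l001 (h b) x a\<close>; skew-symmetry then moves \<open>x\<close> to the
  front on both sides. For \<open>x\<close> in the image of \<open>h\<close> this makes the bracket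
  on degree 1 skew in its last two arguments.\<close>

lemma l001_h_skew: "l001 x (h a) b = - l001 x (h b) a"
  using l3_h[of b a x] l001_skew12[of "h a" x b] l001_skew12[of x "h b" a]
  by (simp add: l100_eq l010_eq)

lemma differential_three_lie_algebra_1:
  "differential_three_lie_algebra w s1 (\<lambda>a b c. l001 (h a) (h b) c) d1"
proof -
  interpret differential_three_lie_representation w s0 l000 d0 s1 l001 d1
    by (rule representation)
  interpret V: vector_space s1 by (rule vector_space_1)
  interpret d1: Vector_Spaces.linear s1 s1 d1 by (rule d1_linear)
  show ?thesis
  proof unfold_locales
    show "trilinear s1 s1 s1 s1 (\<lambda>a b c. l001 (h a) (h b) c)"
      by (rule trilinear_compose_left[OF l001_trilinear h_linear])
    show "l001 (h a) (h b) c = - l001 (h a) (h c) b" for a b c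
      by (rule l001_h_skew)
    show "l001 (h a1) (h a2) (l001 (h b1) (h b2) b3)
        = l001 (h (l001 (h a1) (h a2) b1)) (h b2) b3 + l001 (h b1) (h (l001 (h a1) (h a2) b2)) b3
          + l001 (h b1) (h b2) (l001 (h a1) (h a2) b3)" for a1 a2 b1 b2 b3
      \<comment> \<open>Equivariance turns each inner \<open>h (l001 (h a1) (h a2) b)\<close> into a
        bracket of images under \<open>h\<close>, leaving the commutator law at those
        images.\<close>
      unfolding h_l3 by (rule \<rho>_commutator)
    show "d1 (l001 (h a1) (h a2) a3)
        = l001 (h (d1 a1)) (h a2) a3 + l001 (h a1) (h (d1 a2)) a3 + l001 (h a1) (h a2) (d1 a3)
          + s1 w (l001 (h (d1 a1)) (h (d1 a2)) a3) + s1 w (l001 (h a1) (h (d1 a2)) (d1 a3))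
          + s1 w (l001 (h (d1 a1)) (h a2) (d1 a3)) + s1 (w\<^sup>2) (l001 (h (d1 a1)) (h (d1 a2)) (d1 a3))"
      for a1 a2 a3
      \<comment> \<open>Once every \<open>h (d1 a)\<close> is rewritten to \<open>d0 (h a)\<close>,
        this is \<open>d1_l3\<close> at \<open>h a1\<close> and \<open>h a2\<close>.\<close>
      unfolding d_h[symmetric] by (simp add: d1_l3 V.scale_right_distrib add_ac)
  qed (fact l001_skew12)+
qed

lemma crossed_module:
  "differential_three_lie_crossed_module w s0 s1 l000 (\<lambda>a b c. l001 (h a) (h b) c) h l001 d0 d1"
proof -
  interpret g0: differential_three_lie_algebra w s0 l000 d0
    by (rule differential_three_lie_algebra_0)
  interpret g1: differential_three_lie_algebra w s1 "\<lambda>a b c. l001 (h a) (h b) c" d1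
    by (rule differential_three_lie_algebra_1)
  interpret rep: differential_three_lie_representation w s0 l000 d0 s1 l001 d1
    by (rule representation)
  interpret h: Vector_Spaces.linear s1 s0 h by (rule h_linear)
  show ?thesis
    \<comment> \<open>\<open>h_l3\<close> serves twice: as equivariance and, at images of
      \<open>h\<close>, as preservation of brackets. The choice of bracket makes
      \<open>\<rho>_h_h\<close> reflexivity.\<close>
    by unfold_locales (fact h_l3 d_h[symmetric] l001_h_skew refl)+
qed

end

lemma (in differential_three_lie_crossed_module) strict_2algebra:
  "strict_differential_three_lie_2algebra w s0 s1 h br0 \<rho>
     (\<lambda>x a y. - \<rho> x y a) (\<lambda>a x y. \<rho> x y a) d0 d1"
proof -
  interpret h: Vector_Spaces.linear s1 s0 h by (rule hom.hom_linear)
  interpret d0: Vector_Spaces.linear s0 s0 d0 by (rule g0.d_linear)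
  interpret d1: Vector_Spaces.linear s1 s1 d1 by (rule g1.d_linear)
  show ?thesis
  proof unfold_locales
    show "trilinear s0 s1 s0 s1 (\<lambda>x a y. - \<rho> x y a)"
      by (rule trilinear_neg[OF trilinear_swap23[OF rep.\<rho>_trilinear]])
    show "trilinear s1 s0 s0 s1 (\<lambda>a x y. \<rho> x y a)"
      by (rule trilinear_rotate[OF rep.\<rho>_trilinear])
    show "\<rho> (h b) x a = - \<rho> (h a) x b" for a b x
      \<comment> \<open>\<open>\<rho>_skew\<close> brings \<open>x\<close> to the front,
        \<open>\<rho>_h_skew\<close> exchanges \<open>a\<close> and \<open>b\<close>, and
        \<open>\<rho>_skew\<close> moves \<open>x\<close> back.\<close>
      by (metis \<rho>_h_skew rep.\<rho>_skew)
    show "br0 x1 x2 (br0 x3 x4 x5)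
        = br0 x3 (br0 x1 x2 x4) x5 + br0 (br0 x1 x2 x3) x4 x5 + br0 x3 x4 (br0 x1 x2 x5)"
      for x1 x2 x3 x4 x5
      by (subst g0.br_fundamental) (simp add: add_ac)
    show "\<rho> x2 (br0 x3 x4 x5) a
        = - \<rho> x3 x5 (\<rho> x2 x4 a) + \<rho> x4 x5 (\<rho> x2 x3 a) + \<rho> x3 x4 (\<rho> x2 x5 a)" for a x2 x3 x4 x5
      by (simp add: rep.\<rho>_br)
    show "\<rho> x1 x2 (\<rho> x4 x5 a)
        = \<rho> (br0 x1 x2 x4) x5 a + \<rho> x4 x5 (\<rho> x1 x2 a) + \<rho> x4 (br0 x1 x2 x5) a" for x1 x2 a x4 x5
      by (subst rep.\<rho>_commutator) (simp add: add_ac)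
    show "d0 (br0 x1 x2 x3) = br0 (d0 x1) x2 x3 + br0 x1 (d0 x2) x3 + br0 x1 x2 (d0 x3)
        + s0 w (br0 (d0 x1) (d0 x2) x3 + br0 x1 (d0 x2) (d0 x3) + br0 (d0 x1) x2 (d0 x3))
        + s0 (w\<^sup>2) (br0 (d0 x1) (d0 x2) (d0 x3))" for x1 x2 x3
      by (simp add: g0.d_br g0.scale_right_distrib add_ac)
    show "d1 (\<rho> x1 x2 a) = \<rho> (d0 x1) x2 a + \<rho> x1 (d0 x2) a + \<rho> x1 x2 (d1 a)
        + s1 w (\<rho> (d0 x1) (d0 x2) a + \<rho> x1 (d0 x2) (d1 a) + \<rho> (d0 x1) x2 (d1 a))
        + s1 (w\<^sup>2) (\<rho> (d0 x1) (d0 x2) (d1 a))" for x1 x2 a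
      by (simp add: rep.dV_\<rho> g1.scale_right_distrib power2_eq_square add_ac)
  qed (fact g0.br_trilinear rep.\<rho>_trilinear g0.br_skew12 g0.br_skew23 rep.\<rho>_skew h_\<rho>
      hom.hom_d[symmetric] | simp)+
qed

lemma crossed_module_of_in:
  "S \<in> strict_2algebras w s0 s1 \<Longrightarrow> crossed_module_of S \<in> crossed_modules w s0 s1"
  unfolding strict_2algebras_def crossed_modules_def crossed_module_of_def
  by (simp add: strict_differential_three_lie_2algebra.crossed_module)

lemma strict_2algebra_of_in:
  "C \<in> crossed_modules w s0 s1 \<Longrightarrow> strict_2algebra_of C \<in> strict_2algebras w s0 s1"
  unfolding strict_2algebras_def crossed_modules_def strict_2algebra_of_def
  by (simp add: differential_three_lie_crossed_module.strict_2algebra)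

lemma strict_2algebra_of_crossed_module_of:
  assumes "S \<in> strict_2algebras w s0 s1"
  shows "strict_2algebra_of (crossed_module_of S) = S"
proof -
  interpret strict_differential_three_lie_2algebra w s0 s1
    "sh S" "sl000 S" "sl001 S" "sl010 S" "sl100 S" "sd0 S" "sd1 S"
    using assms by (simp add: strict_2algebras_def)
  show ?thesis
    by (rule two_algebra_data.equality)
      (simp_all add: strict_2algebra_of_def crossed_module_of_def fun_eq_iff l010_eq l100_eq)
qed

lemma crossed_module_of_strict_2algebra_of:
  assumes "C \<in> crossed_modules w s0 s1"
  shows "crossed_module_of (strict_2algebra_of C) = C"
proof -
  interpret differential_three_lie_crossed_module w s0 s1
    "cbr0 C" "cbr1 C" "ch C" "crho C" "cd0 C" "cd1 C"
    using assms by (simp add: crossed_modules_def)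
  show ?thesis
    \<comment> \<open>The 2-algebra does not store \<open>cbr1\<close>; the axiom
      \<open>\<rho>_h_h\<close> recovers it from \<open>crho\<close> and \<open>ch\<close>.\<close>
    by (simp add: strict_2algebra_of_def crossed_module_of_def \<rho>_h_h)
qed

theorem theorem6p5:
  fixes w :: "'k::field_char_0"
    and s0 :: "'k \<Rightarrow> 'a::ab_group_add \<Rightarrow> 'a"
    and s1 :: "'k \<Rightarrow> 'b::ab_group_add \<Rightarrow> 'b"
  assumes "vector_space s0" and "vector_space s1"
  shows "bij_betw crossed_module_of (strict_2algebras w s0 s1) (crossed_modules w s0 s1) \<and>
    bij_betw strict_2algebra_of (crossed_modules w s0 s1) (strict_2algebras w s0 s1) \<and>
    (\<forall>S \<in> strict_2algebras w s0 s1. strict_2algebra_of (crossed_module_of S) = S) \<and>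
    (\<forall>C \<in> crossed_modules w s0 s1. crossed_module_of (strict_2algebra_of C) = C)"
proof (intro conjI)
  let ?A = "strict_2algebras w s0 s1" and ?B = "crossed_modules w s0 s1"
  show left: "\<forall>S\<in>?A. strict_2algebra_of (crossed_module_of S) = S"
    by (intro ballI strict_2algebra_of_crossed_module_of)
  show right: "\<forall>C\<in>?B. crossed_module_of (strict_2algebra_of C) = C"
    by (intro ballI crossed_module_of_strict_2algebra_of)
  have into: "crossed_module_of ` ?A \<subseteq> ?B" "strict_2algebra_of ` ?B \<subseteq> ?A"
    by (auto intro: crossed_module_of_in strict_2algebra_of_in)
  show "bij_betw crossed_module_of ?A ?B"
    by (rule bij_betw_byWitness[OF left right into])
  show "bij_betw strict_2algebra_of ?B ?A"
    by (rule bij_betw_byWitness[OF right left into(2) into(1)])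
qed

end
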